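(* If $X$ is a Banach space that is uniformly nonsquare, then $X$ has the fixed point property.
   Context: Let $X$ be a Banach space with closed unit ball $B_X$. $X$ is uniformly nonsquare if there exists $\delta \in (0,1)$ such that for all $x, y \in B_X$, $$\min\left\{ \left\| \frac{x+y}{2} \right\|, \left\| \frac{x-y}{2} \right\| \right\} \leq 1 - \delta .$$ A Banach space $X$ has the fixed point property (FPP) if for every nonempty closed bounded convex subset $C \subseteq X$, every nonexpansive mapping $T : C \to C$ (i.e. $\|Tx - Ty\| \leq \|x - y\|$ for all $x, y \in C$) has a fixed point in $C$. *)

theory Defs
  imports "HOL-Analysis.Analysis"
begin

text \<open>
  A normed space is represented by a type, so properties of the space as a whole are
  predicates on the type, passed as \<open>TYPE('a)\<close>. The scalars are real; a complex Banach space
  is covered through its underlying real Banach space, as neither notion involves the scalars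
  beyond the reals.
\<close>

definition uniformly_nonsquare :: "'a::real_normed_vector itself \<Rightarrow> bool" where
  "uniformly_nonsquare _ \<longleftrightarrow>
     (\<exists>\<delta>::real. 0 < \<delta> \<and> \<delta> < 1 \<and>
       (\<forall>x\<in>cball (0::'a) 1. \<forall>y\<in>cball 0 1.
          min (norm ((x + y) /\<^sub>R 2)) (norm ((x - y) /\<^sub>R 2)) \<le> 1 - \<delta>))"

text \<open>
  The mapping \<open>T\<close> is a total function on the type, but only its values on \<open>C\<close> are constrained,
  so it stands for an arbitrary self-map of \<open>C\<close>.
\<close>

definition nonexpansive_on :: "'a::real_normed_vector set \<Rightarrow> ('a \<Rightarrow> 'a) \<Rightarrow> bool" where
  "nonexpansive_on C T \<longleftrightarrow> (\<forall>x\<in>C. \<forall>y\<in>C. norm (T x - T y) \<le> norm (x - y))"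

definition fixed_point_property :: "'a::real_normed_vector itself \<Rightarrow> bool" where
  "fixed_point_property _ \<longleftrightarrow>
     (\<forall>C::'a set. C \<noteq> {} \<and> closed C \<and> bounded C \<and> convex C \<longrightarrow>
       (\<forall>T. T \<in> C \<rightarrow> C \<and> nonexpansive_on C T \<longrightarrow> (\<exists>x\<in>C. T x = x)))"

end

theory Submission
  imports Defs
begin

text \<open>
  Uniformly nonsquare spaces are reflexive (James), which enters as a compactness property: a
  family of closed convex sets with the finite intersection property, one of them bounded, has a
  common point. Otherwise a maximal such family yields an ultrafilter that stays at a positive
  distance from every point; a linear combination of points chosen successively along the
  ultrafilter has a norm that ignores how the coefficients are spread out, and two interleaved
  spreadings of an almost optimal alternating combination form an almost perfect square.

  By compactness, a nonexpansive \<open>T\<close> without fixed points has a minimal invariant set \<open>K\<close>, of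
  diameter \<open>d > 0\<close>, and points of \<open>K\<close> that are almost fixed lie at distance almost \<open>d\<close> from any
  given point of \<open>K\<close>. Let \<open>W\<close> be an ultrafilter of approximate fixed points \<open>x\<close> with weak limit
  \<open>p\<close>, and let \<open>z x\<close> be the fixed point of \<open>w \<mapsto> (1 - s) T w + s (p + x) / 2\<close>. Then \<open>z x\<close> is
  almost fixed, so \<open>\<parallel>z x - p\<parallel>\<close> is almost \<open>d\<close>; moreover \<open>\<parallel>z x - z x'\<parallel> \<le> d / 2\<close>, and
  the weak limit \<open>q\<close> of \<open>z\<close> satisfies \<open>\<parallel>q - p\<parallel> \<le> d / 2\<close>. Since \<open>z x'\<close> tends weakly to
  \<open>q\<close>, for suitable \<open>x\<close> and \<open>x'\<close> both \<open>q - p + (z x - z x')\<close> and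
  \<open>q - p - (z x - z x')\<close> have norm almost \<open>d\<close>, which contradicts nonsquareness.
\<close>

section \<open>Finite intersection property and ultrafilters\<close>

definition fip :: "'a set set \<Rightarrow> bool" where
  "fip F \<longleftrightarrow> (\<forall>B\<subseteq>F. finite B \<longrightarrow> \<Inter>B \<noteq> {})"

definition ultra :: "'a filter \<Rightarrow> bool" where
  "ultra U \<longleftrightarrow> U \<noteq> bot \<and> (\<forall>P. eventually P U \<or> eventually (\<lambda>x. \<not> P x) U)"

lemma fip_insert:
  assumes "\<And>B. B \<subseteq> F \<Longrightarrow> finite B \<Longrightarrow> S \<inter> \<Inter>B \<noteq> {}"
  shows "fip (insert S F)"
  unfolding fip_def
proof (intro allI impI)
  fix B assume B: "B \<subseteq> insert S F" "finite B"
  have "S \<inter> \<Inter>(B - {S}) \<noteq> {}"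
    by (rule assms) (use B in auto)
  then show "\<Inter>B \<noteq> {}" by blast
qed

text \<open>Zorn's lemma applies because a finite subfamily of the union of a chain lies in one
  member of the chain. The predicate \<open>P\<close> will be trivial (ultrafilters), closed convex
  (compactness), or closed, convex and invariant (minimal sets).\<close>

lemma maximal_fip_extension:
  assumes "fip F" and P: "\<And>S. S \<in> F \<Longrightarrow> P S"
  obtains M where "F \<subseteq> M" "fip M" "\<And>S. S \<in> M \<Longrightarrow> P S"
    "\<And>S. P S \<Longrightarrow> fip (insert S M) \<Longrightarrow> S \<in> M"
proof -
  let ?A = "{M. F \<subseteq> M \<and> fip M \<and> (\<forall>S\<in>M. P S)}"
  have "\<exists>M\<in>?A. \<forall>X\<in>?A. M \<subseteq> X \<longrightarrow> X = M"
  proof (rule subset_Zorn_nonempty)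
    have "F \<in> ?A" using assms by simp
    then show "?A \<noteq> {}" by (metis empty_iff)
    fix C assume ne: "C \<noteq> {}" and ch: "subset.chain ?A C"
    then have C: "C \<subseteq> ?A" by (simp add: subset_chain_def)
    have "fip (\<Union>C)"
      unfolding fip_def
    proof (intro allI impI)
      fix B assume "B \<subseteq> \<Union>C" "finite B"
      then obtain M where "M \<in> C" "B \<subseteq> M"
        using finite_subset_Union_chain[OF _ _ ne ch] by metis
      with C \<open>finite B\<close> show "\<Inter>B \<noteq> {}" unfolding fip_def by blast
    qed
    with C ne show "\<Union>C \<in> ?A" by blast
  qed
  then obtain M where M: "M \<in> ?A" and max: "\<forall>X\<in>?A. M \<subseteq> X \<longrightarrow> X = M" ..
  show thesis
  proof (rule that)
    fix S assume "P S" "fip (insert S M)"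
    then have "insert S M \<in> ?A" using M by auto
    with max have "M \<subseteq> insert S M \<longrightarrow> insert S M = M" by (rule bspec)
    then show "S \<in> M" by blast
  next
    show "F \<subseteq> M" "fip M" using M by simp_all
    show "P S" if "S \<in> M" for S using M that by simp
  qed
qed

lemma ultrafilter_of_fip:
  assumes "fip F"
  obtains U where "ultra U" "\<And>S. S \<in> F \<Longrightarrow> eventually (\<lambda>x. x \<in> S) U"
proof -
  obtain M where M: "F \<subseteq> M" "fip M" and max: "\<And>S. fip (insert S M) \<Longrightarrow> S \<in> M"
    using maximal_fip_extension[OF assms, of "\<lambda>_. True"] by metis
  define U where "U = (INF S\<in>M. principal S)"
  have mem: "eventually (\<lambda>x. x \<in> S) U" if "S \<in> M" for S
    unfolding U_def by (rule eventually_INF1[OF that]) (simp add: eventually_principal)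
  have "U \<noteq> bot"
    unfolding U_def
  proof (rule INF_filter_not_bot)
    fix X assume X: "X \<subseteq> M" "finite X"
    then have "\<Inter>X \<noteq> {}" using M(2) by (simp add: fip_def)
    then show "(INF S\<in>X. principal S) \<noteq> bot"
      using X by (simp add: INF_principal_finite principal_eq_bot_iff)
  qed
  moreover have "eventually Q U \<or> eventually (\<lambda>x. \<not> Q x) U" for Q
  proof -
    have "{x. Q x} \<in> M \<or> {x. \<not> Q x} \<in> M"
    \<comment> \<open>If neither set belonged to \<open>M\<close>, finite subfamilies
      \<open>B1\<close> and \<open>B2\<close> would exclude both, and their union would have empty
      intersection.\<close>
    proof (rule ccontr)
      assume "\<not> ?thesis"
      then have "\<not> fip (insert {x. Q x} M)" "\<not> fip (insert {x. \<not> Q x} M)"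
        using max by blast+
      then obtain B1 B2 where B: "B1 \<subseteq> M" "finite B1" "{x. Q x} \<inter> \<Inter>B1 = {}"
        "B2 \<subseteq> M" "finite B2" "{x. \<not> Q x} \<inter> \<Inter>B2 = {}"
        using fip_insert by metis
      then have "\<Inter>(B1 \<union> B2) = {}" by blast
      moreover have "\<Inter>(B1 \<union> B2) \<noteq> {}"
        using M(2) B unfolding fip_def by (metis Un_subset_iff finite_UnI)
      ultimately show False by blast
    qed
    then show ?thesis using mem by fastforce
  qed
  ultimately show thesis using that[of U] mem M(1) unfolding ultra_def by blast
qed

text \<open>Compactness of the interval gives a cluster point. Along an ultrafilter it is a limit: a
  neighbourhood that is not entered eventually is avoided eventually.\<close>

lemma ultra_bounded_limit:
  fixes f :: "'a \<Rightarrow> real"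
  assumes "ultra U" and ev: "eventually (\<lambda>y. f y \<in> {a..b}) U"
  obtains l where "l \<in> {a..b}" "(f \<longlongrightarrow> l) U"
proof -
  have "compact {a..b}" by simp
  moreover have "filtermap f U \<noteq> bot" using assms(1) by (simp add: ultra_def filtermap_bot_iff)
  moreover have "eventually (\<lambda>x. x \<in> {a..b}) (filtermap f U)"
    using ev by (simp add: eventually_filtermap)
  ultimately obtain l where l: "l \<in> {a..b}" "inf (nhds l) (filtermap f U) \<noteq> bot"
    unfolding compact_filter by blast
  have "(f \<longlongrightarrow> l) U"
  proof (rule topological_tendstoI, rule ccontr)
    fix S assume S: "open S" "l \<in> S" and "\<not> eventually (\<lambda>x. f x \<in> S) U"
    then have "eventually (\<lambda>x. f x \<notin> S) U" using assms(1) by (auto simp: ultra_def)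
    then have "eventually (\<lambda>x. x \<notin> S) (filtermap f U)" by (simp add: eventually_filtermap)
    moreover have "eventually (\<lambda>x. x \<in> S) (nhds l)" using S by (rule eventually_nhds_in_open)
    ultimately have "eventually (\<lambda>x. False) (inf (nhds l) (filtermap f U))"
      unfolding eventually_inf by blast
    then show False using l(2) by (simp add: trivial_limit_def)
  qed
  with l(1) show thesis by (rule that)
qed

section \<open>Iterated norms along an ultrafilter\<close>

text \<open>Rescaling to the unit ball gives a homogeneous form without norm constraints, which
  passes to iterated limits.\<close>

lemma uniformly_nonsquareE:
  assumes "uniformly_nonsquare TYPE('a::real_normed_vector)"
  obtains \<delta> where "0 < \<delta>" "\<delta> < 1"
    "\<And>x y :: 'a. min (norm ((x + y) /\<^sub>R 2)) (norm ((x - y) /\<^sub>R 2)) \<le> (1 - \<delta>) * max (norm x) (norm y)"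
proof -
  obtain \<delta> where \<delta>: "0 < \<delta>" "\<delta> < 1" and
    ns: "\<And>x y :: 'a. norm x \<le> 1 \<Longrightarrow> norm y \<le> 1 \<Longrightarrow>
      min (norm ((x + y) /\<^sub>R 2)) (norm ((x - y) /\<^sub>R 2)) \<le> 1 - \<delta>"
    using assms unfolding uniformly_nonsquare_def by auto
  have "min (norm ((x + y) /\<^sub>R 2)) (norm ((x - y) /\<^sub>R 2)) \<le> (1 - \<delta>) * max (norm x) (norm y)"
    for x y :: 'a
  proof (cases "max (norm x) (norm y) = 0")
    case True
    then have "norm x \<le> 0" "norm y \<le> 0" by linarith+
    then show ?thesis by simp
  next
    case False
    define t where "t = max (norm x) (norm y)"
    have t: "t > 0" "norm x \<le> t" "norm y \<le> t"
      using False norm_ge_zero[of x] norm_ge_zero[of y] unfolding t_def by linarith+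
    have "norm (x /\<^sub>R t) \<le> 1" "norm (y /\<^sub>R t) \<le> 1"
      using t by (simp_all add: field_simps)
    from ns[OF this]
    have "min (norm ((x /\<^sub>R t + y /\<^sub>R t) /\<^sub>R 2)) (norm ((x /\<^sub>R t - y /\<^sub>R t) /\<^sub>R 2)) \<le> 1 - \<delta>" .
    moreover have "(x /\<^sub>R t + y /\<^sub>R t) /\<^sub>R 2 = ((x + y) /\<^sub>R 2) /\<^sub>R t"
      "(x /\<^sub>R t - y /\<^sub>R t) /\<^sub>R 2 = ((x - y) /\<^sub>R 2) /\<^sub>R t"
      by (simp_all add: scaleR_add_right scaleR_diff_right mult.commute)
    ultimately have "min (norm ((x + y) /\<^sub>R 2) / t) (norm ((x - y) /\<^sub>R 2) / t) \<le> 1 - \<delta>"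
      using t(1) by (simp only: norm_scaleR abs_inverse abs_of_pos divide_inverse_commute)
    then have "min (norm ((x + y) /\<^sub>R 2)) (norm ((x - y) /\<^sub>R 2)) \<le> (1 - \<delta>) * t"
      using t(1) by (simp only: min_le_iff_disj pos_divide_le_eq)
    then show ?thesis unfolding t_def .
  qed
  with \<delta> show thesis by (rule that)
qed

text \<open>
  If \<open>U\<close> converges weak-star to \<open>F\<close> in the bidual, this is the norm of
  \<open>x + a\<^sub>1 F\<^sub>1 + \<dots> + a\<^sub>n F\<^sub>n\<close>, where \<open>F\<^sub>1, \<dots>, F\<^sub>n\<close> are the images of \<open>F\<close> in successive even
  duals.
\<close>

primrec itnorm :: "'a::real_normed_vector filter \<Rightarrow> real list \<Rightarrow> 'a \<Rightarrow> real" where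
  "itnorm U [] x = norm x"
| "itnorm U (a # as) x = Lim U (\<lambda>y. itnorm U as (x + a *\<^sub>R y))"

locale bounded_ultrafilter =
  fixes U :: "'a::real_normed_vector filter" and M :: real
  assumes ultra: "ultra U" and bounded: "eventually (\<lambda>y. norm y \<le> M) U"
begin

lemma nontrivial: "U \<noteq> bot"
  using ultra by (simp add: ultra_def)

text \<open>\<open>Lim\<close> is informative only where the limit exists, and boundedness ensures
  this. In the recursion, \<open>g\<close> is the iterated norm of the remaining
  coefficients.\<close>

lemma Lim_translate:
  fixes a :: real and x :: 'a
  assumes g: "\<And>w. 0 \<le> g w" "\<And>w. g w \<le> norm w + B"
  defines "L \<equiv> Lim U (\<lambda>y. g (x + a *\<^sub>R y))"
  shows "((\<lambda>y. g (x + a *\<^sub>R y)) \<longlongrightarrow> L) U" "0 \<le> L" "L \<le> norm x + M * \<bar>a\<bar> + B"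
proof -
  have "eventually (\<lambda>y. g (x + a *\<^sub>R y) \<in> {0..norm x + M * \<bar>a\<bar> + B}) U"
    using bounded
  proof eventually_elim
    case (elim y)
    have "norm (x + a *\<^sub>R y) \<le> norm x + \<bar>a\<bar> * norm y"
      using norm_triangle_ineq[of x "a *\<^sub>R y"] by simp
    also have "\<bar>a\<bar> * norm y \<le> M * \<bar>a\<bar>" using mult_left_mono[OF elim abs_ge_zero[of a]] by (simp add: mult.commute)
    finally show ?case using g(1,2)[of "x + a *\<^sub>R y"] unfolding atLeastAtMost_iff by linarith
  qed
  then obtain l where l: "l \<in> {0..norm x + M * \<bar>a\<bar> + B}" "((\<lambda>y. g (x + a *\<^sub>R y)) \<longlongrightarrow> l) U"
    by (rule ultra_bounded_limit[OF ultra])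
  have "L = l" unfolding L_def by (rule tendsto_Lim[OF nontrivial l(2)])
  then show "((\<lambda>y. g (x + a *\<^sub>R y)) \<longlongrightarrow> L) U" "0 \<le> L" "L \<le> norm x + M * \<bar>a\<bar> + B"
    using l by simp_all
qed

lemma itnorm_bounds: "0 \<le> itnorm U as x \<and> itnorm U as x \<le> norm x + M * (\<Sum>a\<leftarrow>as. \<bar>a\<bar>)"
proof (induction as arbitrary: x)
  case (Cons a as)
  have "0 \<le> itnorm U as w" "itnorm U as w \<le> norm w + M * (\<Sum>a\<leftarrow>as. \<bar>a\<bar>)" for w
    using Cons by blast+
  from Lim_translate(2,3)[OF this, of x a] show ?case by (simp add: distrib_left)
qed simp

lemma itnorm_nonneg: "0 \<le> itnorm U as x"
  and itnorm_le: "itnorm U as x \<le> norm x + M * (\<Sum>a\<leftarrow>as. \<bar>a\<bar>)"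
  using itnorm_bounds by blast+

lemma itnorm_tendsto: "((\<lambda>y. itnorm U as (x + a *\<^sub>R y)) \<longlongrightarrow> itnorm U (a # as) x) U"
  unfolding itnorm.simps(2) by (rule Lim_translate(1)[OF itnorm_nonneg itnorm_le])

declare itnorm.simps(2) [simp del]

text \<open>A zero coefficient makes the function under the limit constant. Hence all spreadings of
  a list have the same iterated norm.\<close>

lemma itnorm_insert_zeros:
  "itnorm U (xs @ replicate n 0 @ ys) x = itnorm U (xs @ ys) x"
proof (induction xs arbitrary: x)
  case Nil
  have "itnorm U (0 # as) x = itnorm U as x" for as
    by (simp add: itnorm.simps(2) tendsto_Lim[OF nontrivial tendsto_const])
  then show ?case by (induction n) simp_all
next
  case (Cons a xs)
  then show ?case by (simp add: itnorm.simps(2))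
qed

lemma itnorm_uminus: "itnorm U (map uminus as) (- x) = itnorm U as x"
proof (induction as arbitrary: x)
  case (Cons a as)
  have "- x - a *\<^sub>R y = - (x + a *\<^sub>R y)" for y by simp
  then have "itnorm U (map uminus as) (- x - a *\<^sub>R y) = itnorm U as (x + a *\<^sub>R y)" for y
    by (simp only: Cons)
  then show ?case by (simp add: itnorm.simps(2))
qed simp

text \<open>Both lists use the same point at each position, so the inequality holds under each limit
  and survives it by continuity of \<open>min\<close> and \<open>max\<close>.\<close>

lemma itnorm_nonsquare:
  assumes "\<And>x y :: 'a. min (norm ((x + y) /\<^sub>R 2)) (norm ((x - y) /\<^sub>R 2)) \<le> \<theta> * max (norm x) (norm y)"
    and "length as = length bs"
  shows "min (itnorm U (map2 (\<lambda>a b. (a + b) / 2) as bs) ((x + y) /\<^sub>R 2))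
             (itnorm U (map2 (\<lambda>a b. (a - b) / 2) as bs) ((x - y) /\<^sub>R 2))
         \<le> \<theta> * max (itnorm U as x) (itnorm U bs y)"
  using assms(2)
proof (induction as bs arbitrary: x y rule: list_induct2)
  case Nil
  then show ?case using assms(1) by simp
next
  case (Cons a as b bs)
  have sum: "(x + a *\<^sub>R w + (y + b *\<^sub>R w)) /\<^sub>R 2 = (x + y) /\<^sub>R 2 + ((a + b) / 2) *\<^sub>R w" for w
    by (simp add: algebra_simps add_divide_distrib)
  have diff: "(x + a *\<^sub>R w - (y + b *\<^sub>R w)) /\<^sub>R 2 = (x - y) /\<^sub>R 2 + ((a - b) / 2) *\<^sub>R w" for w
    by (simp add: algebra_simps diff_divide_distrib)
  have le: "min (itnorm U (map2 (\<lambda>a b. (a + b) / 2) as bs) ((x + y) /\<^sub>R 2 + ((a + b) / 2) *\<^sub>R w))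
      (itnorm U (map2 (\<lambda>a b. (a - b) / 2) as bs) ((x - y) /\<^sub>R 2 + ((a - b) / 2) *\<^sub>R w))
    \<le> \<theta> * max (itnorm U as (x + a *\<^sub>R w)) (itnorm U bs (y + b *\<^sub>R w))" for w
    using Cons.IH[of "x + a *\<^sub>R w" "y + b *\<^sub>R w"] unfolding sum diff .
  have "min (itnorm U ((a + b) / 2 # map2 (\<lambda>a b. (a + b) / 2) as bs) ((x + y) /\<^sub>R 2))
      (itnorm U ((a - b) / 2 # map2 (\<lambda>a b. (a - b) / 2) as bs) ((x - y) /\<^sub>R 2))
    \<le> \<theta> * max (itnorm U (a # as) x) (itnorm U (b # bs) y)"
    by (rule tendsto_le[OF nontrivial tendsto_mult[OF tendsto_const tendsto_max[OF itnorm_tendsto itnorm_tendsto]]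
      tendsto_min[OF itnorm_tendsto itnorm_tendsto] always_eventually[OF allI[OF le]]])
  then show ?case by simp
qed

lemma itnorm_append_lower:
  assumes "\<And>x. r \<le> itnorm U ys x"
  shows "r \<le> itnorm U (xs @ ys) x"
proof (induction xs arbitrary: x)
  case (Cons a xs)
  show ?case
    unfolding append_Cons
    by (rule tendsto_lowerbound[OF itnorm_tendsto always_eventually[OF allI[OF Cons]] nontrivial])
qed (simp add: assms)

text \<open>Reading the list keeps the vector in the form \<open>\<mu> *\<^sub>R c - b\<close> with
  \<open>c\<close> in \<open>C\<close> and \<open>\<mu>\<close> the mass collected so far; once the
  mass is 1, \<open>far\<close> applies.\<close>

lemma itnorm_convex_lower:
  assumes "convex C" and C: "eventually (\<lambda>y. y \<in> C) U" and far: "\<And>c. c \<in> C \<Longrightarrow> r \<le> norm (c - b)"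
    and "c \<in> C" "0 \<le> \<mu>" "\<And>a. a \<in> set as \<Longrightarrow> 0 \<le> a" "\<mu> + sum_list as = 1"
  shows "r \<le> itnorm U as (\<mu> *\<^sub>R c - b)"
  using assms(4-)
proof (induction as arbitrary: c \<mu>)
  case Nil
  then show ?case using far by simp
next
  case (Cons a as)
  have "eventually (\<lambda>y. r \<le> itnorm U as (\<mu> *\<^sub>R c - b + a *\<^sub>R y)) U"
    using C
  proof eventually_elim
    case (elim y)
    have nonneg: "0 \<le> \<mu>" "0 \<le> a" using Cons.prems by simp_all
    obtain c' where c': "c' \<in> C" "\<mu> *\<^sub>R c + a *\<^sub>R y = (\<mu> + a) *\<^sub>R c'"
    proof (cases "\<mu> + a = 0")
      case True
      then have "\<mu> = 0" "a = 0" using nonneg by linarith+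
      with elim show ?thesis using that[of y] by simp
    next
      case False
      then have pos: "\<mu> + a > 0" using nonneg by linarith
      have "(\<mu> / (\<mu> + a)) *\<^sub>R c + (a / (\<mu> + a)) *\<^sub>R y \<in> C"
        using pos nonneg by (intro convexD[OF assms(1) Cons.prems(1) elim]) (simp_all flip: add_divide_distrib)
      moreover have "\<mu> *\<^sub>R c + a *\<^sub>R y = (\<mu> + a) *\<^sub>R ((\<mu> / (\<mu> + a)) *\<^sub>R c + (a / (\<mu> + a)) *\<^sub>R y)"
        using pos by (simp add: scaleR_add_right)
      ultimately show ?thesis by (rule that)
    qed
    have "r \<le> itnorm U as ((\<mu> + a) *\<^sub>R c' - b)"
      using Cons.prems nonneg by (intro Cons.IH[OF c'(1)]) simp_all
    moreover have "\<mu> *\<^sub>R c - b + a *\<^sub>R y = (\<mu> + a) *\<^sub>R c' - b"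
      unfolding c'(2)[symmetric] by (simp add: algebra_simps)
    ultimately show ?case by (simp only:)
  qed
  then show ?case by (rule tendsto_lowerbound[OF itnorm_tendsto _ nontrivial])
qed

end

section \<open>Alternating combinations and compactness\<close>

abbreviation halve :: "real list \<Rightarrow> real list" where
  "halve \<equiv> map (\<lambda>a. a / 2)"

text \<open>
  In terms of tail sums: \<open>zigzag \<sigma> ss\<close> makes the sums of \<open>concat ss\<close> from the start of each block
  onwards alternate between \<open>\<sigma>\<close> and \<open>- \<sigma>\<close>. Requiring a constant sign inside each block is
  what turns the last block into a multiple of a convex combination.
\<close>

fun zigzag :: "real \<Rightarrow> real list list \<Rightarrow> bool" where
  "zigzag \<sigma> [] \<longleftrightarrow> False"
| "zigzag \<sigma> [s] \<longleftrightarrow> sum_list s = \<sigma> \<and> (\<forall>a\<in>set s. 0 \<le> \<sigma> * a)"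
| "zigzag \<sigma> (s # t # ss) \<longleftrightarrow>
     sum_list s = 2 * \<sigma> \<and> (\<forall>a\<in>set s. 0 \<le> \<sigma> * a) \<and> zigzag (- \<sigma>) (t # ss)"

text \<open>
  Two spreadings of the same coefficient list, interleaved block by block. They share the last
  block, so that no remainder is left at the end of their difference.
\<close>

fun lead :: "real list list \<Rightarrow> real list" where
  "lead [] = []"
| "lead [s] = s"
| "lead (s # t # ss) = s @ replicate (length s) 0 @ lead (t # ss)"

fun lag :: "real list list \<Rightarrow> real list" where
  "lag [] = []"
| "lag [s] = s"
| "lag (s # t # ss) = replicate (length s) 0 @ s @ lag (t # ss)"

text \<open>Half the sum of the two spreadings, followed by half their difference. In
  \<open>mean\<close> both copies of a halved block stay in one block, which preserves the block
  sums and so the alternation.\<close>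

fun mean :: "real list list \<Rightarrow> real list list" where
  "mean [] = []"
| "mean [s] = [s]"
| "mean (s # t # ss) = (halve s @ halve s) # mean (t # ss)"

fun half_diff :: "real list list \<Rightarrow> real list" where
  "half_diff [] = []"
| "half_diff [s] = replicate (length s) 0"
| "half_diff (s # t # ss) = halve s @ map uminus (halve s) @ half_diff (t # ss)"

text \<open>
  Cuts \<open>c @ half_diff ss\<close> in the middle of the pairs \<open>halve s, - halve s\<close>. Consecutive blocks
  have opposite signs, so each new block has a constant sign.
\<close>

fun regroup :: "real list \<Rightarrow> real list list \<Rightarrow> real list list" where
  "regroup c [] = []"
| "regroup c [s] = [c @ replicate (length s) 0]"
| "regroup c (s # t # ss) = (c @ halve s) # regroup (map uminus (halve s)) (t # ss)"

section \<open>Arithmetic of alternating blocks\<close>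

lemma sum_list_halve: "sum_list (halve s) = sum_list s / 2"
  by (induction s) (simp_all add: add_divide_distrib)

lemma sum_list_uminus: "sum_list (map uminus s) = - sum_list s" for s :: "real list"
  by (induction s) simp_all

lemma length_lead_lag: "length (lead ss) = length (lag ss)"
  by (induction ss rule: lead.induct) simp_all

lemma map2_replicate_zero_right:
  "length xs = n \<Longrightarrow> map2 f xs (replicate n z) = map (\<lambda>a. f a z) xs"
  by (induction xs arbitrary: n) auto

lemma map2_replicate_zero_left:
  "length xs = n \<Longrightarrow> map2 f (replicate n z) xs = map (f z) xs"
  by (induction xs arbitrary: n) auto

lemma map2_self: "map2 f xs xs = map (\<lambda>a. f a a) xs"
  by (induction xs) auto

lemma map2_lead_lag_mean: "map2 (\<lambda>a b. (a + b) / 2) (lead ss) (lag ss) = concat (mean ss)"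
  by (induction ss rule: lead.induct)
    (simp_all add: map2_self map2_replicate_zero_left map2_replicate_zero_right)

lemma map2_lead_lag_half_diff: "map2 (\<lambda>a b. (a - b) / 2) (lead ss) (lag ss) = half_diff ss"
  by (induction ss rule: lead.induct)
    (simp_all add: map2_self map2_replicate_zero_left map2_replicate_zero_right map_replicate_const o_def)

lemma mean_zigzag:
  "zigzag \<sigma> ss \<Longrightarrow> zigzag \<sigma> (mean ss) \<and> length (mean ss) = length ss"
proof (induction \<sigma> ss rule: zigzag.induct)
  case (3 \<sigma> s t ss)
  then have "zigzag (- \<sigma>) (mean (t # ss))" "length (mean (t # ss)) = length (t # ss)" by simp_all
  moreover obtain t' ss' where "mean (t # ss) = t' # ss'" by (cases ss) simp_all
  ultimately show ?case using 3 by (auto simp: sum_list_halve)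
qed auto

text \<open>The carry \<open>c\<close> and half of the next block each sum to
  \<open>\<sigma>\<close>, so together they form a block of sum \<open>2 * \<sigma>\<close>; the
  negated half is the next carry, of sum \<open>- \<sigma>\<close>. The last carry, padded with
  zeros, is the final block.\<close>

lemma regroup_zigzag:
  "zigzag \<sigma> ss \<Longrightarrow> sum_list c = \<sigma> \<Longrightarrow> \<forall>a\<in>set c. 0 \<le> \<sigma> * a \<Longrightarrow>
    zigzag \<sigma> (regroup c ss) \<and> length (regroup c ss) = length ss \<and>
    concat (regroup c ss) = c @ half_diff ss"
proof (induction \<sigma> ss arbitrary: c rule: zigzag.induct)
  case (3 \<sigma> s t ss)
  let ?d = "map uminus (halve s)"
  have "zigzag (- \<sigma>) (t # ss)" "sum_list ?d = - \<sigma>" "\<forall>a\<in>set ?d. 0 \<le> - \<sigma> * a"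
    using 3(2) by (auto simp: sum_list_halve sum_list_uminus simp del: map_map)
  from 3(1)[OF this]
  have "zigzag (- \<sigma>) (regroup ?d (t # ss))" "length (regroup ?d (t # ss)) = length (t # ss)"
    "concat (regroup ?d (t # ss)) = ?d @ half_diff (t # ss)"
    by blast+
  moreover obtain t' ss' where *: "regroup ?d (t # ss) = t' # ss'" by (cases ss) simp_all
  ultimately show ?case
    using 3 unfolding regroup.simps by (auto simp: sum_list_halve)
qed (auto simp: sum_list_replicate)

fun zigzag_singletons :: "real \<Rightarrow> nat \<Rightarrow> real list list" where
  "zigzag_singletons \<sigma> 0 = [[\<sigma>]]"
| "zigzag_singletons \<sigma> (Suc n) = [2 * \<sigma>] # zigzag_singletons (- \<sigma>) n"

text \<open>Alternating lists of every length exist with total absolute value linear in the length;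
  this bounds \<open>K\<close> from above.\<close>

lemma zigzag_singletons:
  "zigzag \<sigma> (zigzag_singletons \<sigma> n) \<and> length (zigzag_singletons \<sigma> n) = Suc n \<and>
    (\<Sum>a\<leftarrow>concat (zigzag_singletons \<sigma> n). \<bar>a\<bar>) \<le> 2 * \<bar>\<sigma>\<bar> * real (Suc n)"
proof (induction n arbitrary: \<sigma>)
  case (Suc n)
  moreover obtain t' ss' where "zigzag_singletons (- \<sigma>) n = t' # ss'" by (cases n) simp_all
  ultimately show ?case using Suc[of "- \<sigma>"] by (auto simp: algebra_simps abs_mult)
qed auto

section \<open>Iterated norms of alternating combinations\<close>

context bounded_ultrafilter
begin

lemma itnorm_lead: "itnorm U (xs @ lead ss) x = itnorm U (xs @ concat ss) x"
proof (induction ss arbitrary: xs rule: lead.induct)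
  case (3 s t ss)
  have "itnorm U (xs @ lead (s # t # ss)) x = itnorm U ((xs @ s) @ lead (t # ss)) x"
    using itnorm_insert_zeros[of "xs @ s" "length s" "lead (t # ss)"] by simp
  then show ?case using 3[of "xs @ s"] by simp
qed simp_all

lemma itnorm_lag: "itnorm U (xs @ lag ss) x = itnorm U (xs @ concat ss) x"
proof (induction ss arbitrary: xs rule: lead.induct)
  case (3 s t ss)
  have "itnorm U (xs @ lag (s # t # ss)) x = itnorm U ((xs @ s) @ lag (t # ss)) x"
    using itnorm_insert_zeros[of xs "length s" "s @ lag (t # ss)"] by simp
  then show ?case using 3[of "xs @ s"] by simp
qed simp_all

text \<open>The bound is uniform in \<open>x\<close>, so it suffices to treat the last block, which
  is a convex combination up to sign.\<close>

lemma itnorm_zigzag_lower: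
  assumes far: "\<And>b. \<exists>C. convex C \<and> eventually (\<lambda>y. y \<in> C) U \<and> (\<forall>c\<in>C. r \<le> norm (c - b))"
  shows "\<bar>\<sigma>\<bar> = 1 \<Longrightarrow> zigzag \<sigma> ss \<Longrightarrow> r \<le> itnorm U (concat ss) x"
proof (induction \<sigma> ss arbitrary: x rule: zigzag.induct)
  case (2 \<sigma> s)
  have pos: "r \<le> itnorm U as x" if "sum_list as = 1" "\<And>a. a \<in> set as \<Longrightarrow> 0 \<le> a" for as x
  proof -
    obtain C where C: "convex C" "eventually (\<lambda>y. y \<in> C) U" "\<And>c. c \<in> C \<Longrightarrow> r \<le> norm (c - (- x))"
      using far[of "- x"] by blast
    then obtain c where "c \<in> C" using eventually_happens'[OF nontrivial] by blast
    from itnorm_convex_lower[OF C this order_refl, of as] that show ?thesis by simp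
  qed
  show ?case
  proof (cases "\<sigma> = 1")
    case True
    with 2 pos[of s x] show ?thesis by simp
  next
    case False
    with 2 have "\<sigma> = - 1" by linarith
    with 2 pos[of "map uminus s" "- x"] show ?thesis
      by (simp add: itnorm_uminus sum_list_uminus) (metis (no_types, lifting) imageE neg_0_le_iff_le)
  qed
next
  case (3 \<sigma> s t ss)
  then have "r \<le> itnorm U (concat (t # ss)) x" for x by simp
  from itnorm_append_lower[OF this, of s] show ?case by simp
qed simp

text \<open>
  \<open>K n\<close> is the least iterated norm of a list with \<open>n + 1\<close> alternating blocks after the initial
  one. The mean of two spreadings of such a list has as many blocks and their half difference one
  fewer, so nonsquareness forces \<open>K\<close> to grow geometrically, whereas it grows at most linearly.
\<close>

lemma nonsquare_no_escape:
  assumes "0 < \<delta>" "\<delta> < 1" "0 < r"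
    and ns: "\<And>x y :: 'a. min (norm ((x + y) /\<^sub>R 2)) (norm ((x - y) /\<^sub>R 2)) \<le> (1 - \<delta>) * max (norm x) (norm y)"
    and far: "\<And>b. \<exists>C. convex C \<and> eventually (\<lambda>y. y \<in> C) U \<and> (\<forall>c\<in>C. r \<le> norm (c - b))"
  shows False
proof -
  \<comment> \<open>The initial block \<open>s\<close> is unconstrained so that it can absorb the
    entries of a half difference that precede the alternating blocks.\<close>
  define Z where "Z n = {itnorm U (concat (s # ss)) 0 |s ss \<sigma>. \<bar>\<sigma>\<bar> = 1 \<and> zigzag \<sigma> ss \<and> length ss = Suc n}" for n
  have Z_I: "itnorm U (xs @ concat ss) 0 \<in> Z n" if "\<bar>\<sigma>\<bar> = 1" "zigzag \<sigma> ss" "length ss = Suc n" for xs ss \<sigma> n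
    unfolding Z_def using that by force
  have lower: "r \<le> w" if "w \<in> Z n" for w n
    using that itnorm_append_lower[OF itnorm_zigzag_lower[OF far]] by (auto simp: Z_def)
  have bdd: "bdd_below (Z n)" for n using lower by (rule bdd_belowI)
  have sing: "itnorm U (concat (zigzag_singletons 1 n)) 0 \<in> Z n" for n
    using Z_I[of 1 "zigzag_singletons 1 n" n "[]"] zigzag_singletons[of 1 n] by simp
  then have ne: "Z n \<noteq> {}" for n by blast
  define K where "K n = Inf (Z n)" for n
  have K_lower: "r \<le> K n" for n
    unfolding K_def using ne lower by (rule cInf_greatest)
  obtain m0 :: 'a where m0: "norm m0 \<le> M" using eventually_happens'[OF nontrivial bounded] by blast
  then have "0 \<le> M" using norm_ge_zero order_trans by blast
  have K_upper: "K n \<le> M * (2 * real (Suc n))" for n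
  proof -
    have "K n \<le> itnorm U (concat (zigzag_singletons 1 n)) 0"
      unfolding K_def using sing bdd by (rule cInf_lower)
    also have "\<dots> \<le> M * (\<Sum>a\<leftarrow>concat (zigzag_singletons 1 n). \<bar>a\<bar>)"
      using itnorm_le[of _ 0] by simp
    also have "\<dots> \<le> M * (2 * real (Suc n))"
      using zigzag_singletons[of 1 n] \<open>0 \<le> M\<close> by (intro mult_left_mono) simp_all
    finally show ?thesis .
  qed
  have step: "min (K (Suc n)) (K n) \<le> (1 - \<delta>) * w" if "w \<in> Z (Suc n)" for n w
  proof -
    obtain s ss \<sigma> where w: "w = itnorm U (concat (s # ss)) 0" "\<bar>\<sigma>\<bar> = 1" "zigzag \<sigma> ss" "length ss = Suc (Suc n)"
      using \<open>w \<in> Z (Suc n)\<close> unfolding Z_def by blast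
    obtain t t' ss' where ss: "ss = t # t' # ss'"
      using w(4) by (auto simp: length_Suc_conv)
    let ?m = "itnorm U (concat (mean (s # ss))) 0" and ?d = "itnorm U (half_diff (s # ss)) 0"
    have "min ?m ?d \<le> (1 - \<delta>) * w"
      \<comment> \<open>Both spreadings have iterated norm \<open>w\<close>, so nonsquareness
        applies to them with the same bound.\<close>
      using itnorm_nonsquare[OF ns length_lead_lag, of "s # ss" 0 0]
      by (simp only: map2_lead_lag_mean map2_lead_lag_half_diff w(1) max.idem add_0 diff_zero scaleR_zero_right
          itnorm_lead[of "[]", unfolded append_Nil] itnorm_lag[of "[]", unfolded append_Nil])
    moreover have "?m \<in> Z (Suc n)"
      using Z_I[of \<sigma> "mean ss" "Suc n" "halve s @ halve s"] mean_zigzag[OF w(3)] w(2,4) by (simp add: ss)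
    moreover have "?d \<in> Z n"
    proof -
      \<comment> \<open>Everything up to \<open>halve t\<close> joins the initial block; the negated
        half of \<open>t\<close> is the carry for the remaining blocks, which start with
        \<open>- \<sigma>\<close>.\<close>
      let ?c = "map uminus (halve t)"
      have z: "zigzag (- \<sigma>) (t' # ss')" "sum_list ?c = - \<sigma>" "\<forall>a\<in>set ?c. 0 \<le> - \<sigma> * a"
        using w(3) by (auto simp: ss sum_list_halve sum_list_uminus simp del: map_map)
      from regroup_zigzag[OF this] have "itnorm U ((halve s @ map uminus (halve s) @ halve t) @
          concat (regroup ?c (t' # ss'))) 0 \<in> Z n"
        using w(2,4) by (intro Z_I[of "- \<sigma>"]) (simp_all add: ss)
      then show ?thesis using regroup_zigzag[OF z] by (simp add: ss)
    qed
    ultimately show ?thesis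
      unfolding K_def using cInf_lower[OF _ bdd] by (smt (verit, best) min_le_iff_disj order_trans)
  qed
  have contract: "K n \<le> (1 - \<delta>) * K (Suc n)" for n
  proof -
    have "min (K (Suc n)) (K n) / (1 - \<delta>) \<le> w" if "w \<in> Z (Suc n)" for w
      using step[OF that] \<open>\<delta> < 1\<close> by (simp add: pos_divide_le_eq mult.commute)
    then have "min (K (Suc n)) (K n) / (1 - \<delta>) \<le> Inf (Z (Suc n))"
      by (rule cInf_greatest[OF ne])
    then have "min (K (Suc n)) (K n) / (1 - \<delta>) \<le> K (Suc n)"
      by (simp only: K_def[of "Suc n"])
    then have "min (K (Suc n)) (K n) \<le> (1 - \<delta>) * K (Suc n)"
      using \<open>\<delta> < 1\<close> by (simp add: pos_divide_le_eq mult.commute)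
    \<comment> \<open>Positivity of \<open>K\<close> excludes \<open>K (Suc n)\<close> as the
      minimum.\<close>
    moreover have "(1 - \<delta>) * K (Suc n) < K (Suc n)"
      using K_lower[of "Suc n"] \<open>0 < r\<close> \<open>0 < \<delta>\<close> by (simp add: algebra_simps)
    ultimately show ?thesis by linarith
  qed
  have iter: "r \<le> (1 - \<delta>) ^ n * K n" for n
  proof (induction n)
    case (Suc n)
    have "(1 - \<delta>) ^ n * K n \<le> (1 - \<delta>) ^ n * ((1 - \<delta>) * K (Suc n))"
      using contract \<open>\<delta> < 1\<close> by (intro mult_left_mono) simp_all
    with Suc show ?case by (simp add: algebra_simps)
  qed (simp add: K_lower)
  have "r \<le> 2 * M * (real n * (1 - \<delta>) ^ n + (1 - \<delta>) ^ n)" for n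
  proof -
    have "(1 - \<delta>) ^ n * K n \<le> (1 - \<delta>) ^ n * (M * (2 * real (Suc n)))"
      using K_upper \<open>\<delta> < 1\<close> by (intro mult_left_mono) simp_all
    with iter[of n] show ?thesis by (simp add: algebra_simps)
  qed
  moreover have "(\<lambda>n. 2 * M * (real n * (1 - \<delta>) ^ n + (1 - \<delta>) ^ n)) \<longlonglongrightarrow> 2 * M * (0 + 0)"
    using \<open>0 < \<delta>\<close> \<open>\<delta> < 1\<close> by (intro tendsto_intros powser_times_n_limit_0 LIMSEQ_realpow_zero) simp_all
  ultimately have "r \<le> 2 * M * (0 + 0)"
    by (intro tendsto_lowerbound[where F = sequentially]) auto
  with \<open>0 < r\<close> show False by simp
qed

end

section \<open>Compactness of closed convex sets\<close>

theorem nonsquare_convex_compact: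
  fixes F :: "'a::banach set set"
  assumes ns: "uniformly_nonsquare TYPE('a)"
    and "fip F" and F: "\<And>S. S \<in> F \<Longrightarrow> closed S \<and> convex S" and "B \<in> F" "bounded B"
  shows "\<Inter>F \<noteq> {}"
proof
  assume empty: "\<Inter>F = {}"
  obtain M where M: "F \<subseteq> M" "fip M" "\<And>S. S \<in> M \<Longrightarrow> closed S \<and> convex S"
    and max: "\<And>S. closed S \<and> convex S \<Longrightarrow> fip (insert S M) \<Longrightarrow> S \<in> M"
    using maximal_fip_extension[OF \<open>fip F\<close>, of "\<lambda>S. closed S \<and> convex S"] F by blast
  \<comment> \<open>Otherwise \<open>M\<close> contains arbitrarily small balls. Members of
    \<open>M\<close> meet pairwise, so the centres form a Cauchy sequence, and its limit lies in
    every member of \<open>M\<close>, hence of \<open>F\<close>.\<close>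
  have "\<exists>r>0. \<forall>b. cball b r \<notin> M"
  proof (rule ccontr)
    assume "\<not> ?thesis"
    then have "\<forall>n. \<exists>b. cball b (inverse (real (Suc n))) \<in> M"
      by (metis inverse_positive_iff_positive of_nat_0_less_iff zero_less_Suc)
    then obtain b where b: "\<And>n. cball (b n) (inverse (real (Suc n))) \<in> M" by metis
    have meet: "S \<inter> S' \<noteq> {}" if "S \<in> M" "S' \<in> M" for S S'
      using M(2)[unfolded fip_def, rule_format, of "{S, S'}"] that by simp
    have "Cauchy b"
    proof (rule metric_CauchyI)
      fix e :: real assume "0 < e"
      then obtain N where N: "inverse (real (Suc N)) < e / 2" using reals_Archimedean[of "e / 2"] by auto
      have "dist (b m) (b n) < e" if "m \<ge> N" "n \<ge> N" for m n
      proof -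
        obtain z where "dist (b m) z \<le> inverse (real (Suc m))" "dist (b n) z \<le> inverse (real (Suc n))"
          using meet[OF b[of m] b[of n]] by auto
        moreover have "inverse (real (Suc m)) \<le> inverse (real (Suc N))" "inverse (real (Suc n)) \<le> inverse (real (Suc N))"
          using that by (simp_all add: le_imp_inverse_le)
        ultimately show ?thesis using N dist_triangle2[of "b m" "b n" z] by linarith
      qed
      then show "\<exists>N. \<forall>m\<ge>N. \<forall>n\<ge>N. dist (b m) (b n) < e" by blast
    qed
    then obtain l where l: "b \<longlonglongrightarrow> l" using Cauchy_convergent convergent_def by blast
    have "l \<in> S" if "S \<in> M" for S
    proof -
      have "\<exists>y. y \<in> S \<and> dist (b n) y \<le> inverse (real (Suc n))" for n
        using meet[OF that b[of n]] by auto
      then obtain y where y: "\<And>n. y n \<in> S" "\<And>n. dist (b n) (y n) \<le> inverse (real (Suc n))" by metis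
      have "(\<lambda>n. y n - b n) \<longlonglongrightarrow> 0"
        by (rule Lim_null_comparison[OF always_eventually LIMSEQ_inverse_real_of_nat])
          (use y(2) in \<open>simp add: dist_norm norm_minus_commute\<close>)
      from tendsto_add[OF this l] have "y \<longlonglongrightarrow> l" by simp
      then show ?thesis using M(3)[OF that] y(1) closed_sequentially by blast
    qed
    with M(1) empty show False by blast
  qed
  then obtain r where r: "0 < r" "\<And>b. cball b r \<notin> M" by blast
  obtain U where U: "ultra U" "\<And>S. S \<in> M \<Longrightarrow> eventually (\<lambda>x. x \<in> S) U"
    using ultrafilter_of_fip[OF M(2)] by blast
  obtain m where m: "\<And>y. y \<in> B \<Longrightarrow> norm y \<le> m" using \<open>bounded B\<close> by (auto simp: bounded_iff)
  have "eventually (\<lambda>y. norm y \<le> m) U"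
    by (rule eventually_mono[OF U(2)[of B]]) (use M(1) \<open>B \<in> F\<close> m in auto)
  with U(1) interpret bounded_ultrafilter U m by unfold_locales
  \<comment> \<open>By maximality, a ball outside \<open>M\<close> misses a finite intersection of
    members of \<open>M\<close>, which is convex and holds eventually along
    \<open>U\<close>.\<close>
  have far: "\<exists>C. convex C \<and> eventually (\<lambda>y. y \<in> C) U \<and> (\<forall>c\<in>C. r \<le> norm (c - b))" for b
  proof -
    have "\<not> fip (insert (cball b r) M)" using max[of "cball b r"] r(2) by auto
    then obtain D where D: "D \<subseteq> M" "finite D" "cball b r \<inter> \<Inter>D = {}" using fip_insert by metis
    have "convex (\<Inter>D)" using D(1) M(3) by (intro convex_Inter) blast
    moreover have "eventually (\<lambda>y. y \<in> \<Inter>D) U"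
    proof -
      have "eventually (\<lambda>y. \<forall>S\<in>D. y \<in> S) U"
        by (rule eventually_ball_finite[OF D(2)]) (use D(1) U(2) in blast)
      then show ?thesis by (simp only: Inter_iff)
    qed
    moreover have "r \<le> norm (c - b)" if "c \<in> \<Inter>D" for c
    proof -
      have "c \<notin> cball b r" using D(3) that by blast
      then show ?thesis by (simp add: dist_norm norm_minus_commute)
    qed
    ultimately show ?thesis by blast
  qed
  obtain \<delta> where "0 < \<delta>" "\<delta> < 1"
    "\<And>x y :: 'a. min (norm ((x + y) /\<^sub>R 2)) (norm ((x - y) /\<^sub>R 2)) \<le> (1 - \<delta>) * max (norm x) (norm y)"
    using uniformly_nonsquareE[OF ns] by blast
  from nonsquare_no_escape[OF this(1,2) r(1) this(3) far] show False .
qed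

section \<open>Nonexpansive maps\<close>

text \<open>
  When \<open>W\<close> is an ultrafilter this says that \<open>q\<close> is the weak limit of \<open>f\<close> along \<open>W\<close>, but it is
  phrased without functionals.
\<close>

definition conv_cluster :: "'i filter \<Rightarrow> ('i \<Rightarrow> 'b::real_normed_vector) \<Rightarrow> 'b \<Rightarrow> bool" where
  "conv_cluster W f q \<longleftrightarrow> (\<forall>A. eventually (\<lambda>x. x \<in> A) W \<longrightarrow> q \<in> closure (convex hull (f ` A)))"

lemma closure_convex_hull_inc: "x \<in> A \<Longrightarrow> x \<in> closure (convex hull A)"
  by (rule subsetD[OF closure_subset hull_inc])

lemma conv_cluster_mem:
  assumes "conv_cluster W f q" "eventually (\<lambda>x. f x \<in> S) W" "closed S" "convex S"
  shows "q \<in> S"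
proof -
  have "q \<in> closure (convex hull (f ` {x. f x \<in> S}))"
    using assms(1,2) by (simp add: conv_cluster_def)
  moreover have "convex hull (f ` {x. f x \<in> S}) \<subseteq> S"
    using assms(4) by (intro hull_minimal) auto
  ultimately show ?thesis using assms(3) closure_minimal by blast
qed

text \<open>\<open>G A e\<close> is an approximate fibre over \<open>p\<close>: second components of
  convex combinations whose first component is within \<open>e\<close> of \<open>p\<close>. These
  sets are nonempty and directed, so compactness in the second factor gives \<open>q\<close>. A
  joint limit lets convex constraints on pairs carry over to \<open>(p, q)\<close>.\<close>

lemma conv_cluster_joint:
  fixes g :: "'i \<Rightarrow> 'b::real_normed_vector" and z :: "'i \<Rightarrow> 'a::banach"
  assumes ns: "uniformly_nonsquare TYPE('a)" and g: "conv_cluster W g p"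
    and z: "eventually (\<lambda>x. z x \<in> B) W" "bounded B"
  obtains q where "conv_cluster W (\<lambda>x. (g x, z x)) (p, q)"
proof -
  define H where "H A = convex hull ((\<lambda>x. (g x, z x)) ` A)" for A
  define G where "G A e = snd ` (H A \<inter> cball p e \<times> UNIV)" for A e
  define F where "F = {closure (G A e) |A e. eventually (\<lambda>x. x \<in> A) W \<and> 0 < e}"
  have H_fst: "fst ` H A = convex hull (g ` A)" and H_snd: "snd ` H A = convex hull (z ` A)" for A
    unfolding H_def by (simp_all add: convex_hull_linear_image linear_fst linear_snd image_image)
  have ne: "G A e \<noteq> {}" if A: "eventually (\<lambda>x. x \<in> A) W" and "0 < e" for A e
  proof -
    have "p \<in> closure (fst ` H A)" using g A by (simp add: H_fst conv_cluster_def)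
    then obtain w where "w \<in> H A" "dist p (fst w) < e"
      using closure_approachableD \<open>0 < e\<close> by blast
    then have "w \<in> H A \<inter> cball p e \<times> UNIV" by (cases w) simp
    then show ?thesis unfolding G_def by blast
  qed
  have mono: "G A e \<subseteq> G A' e'" if "A \<subseteq> A'" "e \<le> e'" for A A' e e'
    unfolding G_def H_def using that by (intro image_mono Int_mono Sigma_mono hull_mono) auto
  have "fip F"
    unfolding fip_def
  proof (intro allI impI)
    fix D assume "D \<subseteq> F" "finite D"
    have "\<exists>A e. eventually (\<lambda>x. x \<in> A) W \<and> 0 < e \<and> G A e \<subseteq> \<Inter>D"
      using \<open>finite D\<close> \<open>D \<subseteq> F\<close>
    proof (induction D rule: finite_induct)
      case empty
      show ?case by (rule exI[of _ UNIV], rule exI[of _ 1]) simp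
    next
      case (insert S D)
      then obtain A e where A: "eventually (\<lambda>x. x \<in> A) W" "0 < e" "G A e \<subseteq> \<Inter>D" by auto
      obtain A' e' where A': "eventually (\<lambda>x. x \<in> A') W" "0 < e'" "S = closure (G A' e')"
        using insert.prems unfolding F_def by blast
      have "G (A \<inter> A') (min e e') \<subseteq> G A e" "G (A \<inter> A') (min e e') \<subseteq> closure (G A' e')"
        by (rule mono, simp, simp) (rule order_trans[OF mono closure_subset], simp_all)
      then have "G (A \<inter> A') (min e e') \<subseteq> \<Inter>(insert S D)" using A(3) A'(3) by blast
      moreover have "eventually (\<lambda>x. x \<in> A \<inter> A') W" "0 < min e e'"
        using A A' by (simp_all add: eventually_conj)
      ultimately show ?case by blast
    qed
    with ne show "\<Inter>D \<noteq> {}" by blast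
  qed
  moreover have "closed S \<and> convex S" if "S \<in> F" for S
    using that unfolding F_def G_def H_def
    by (auto intro!: convex_closure convex_linear_image linear_snd convex_Int convex_Times)
  moreover have "closure (G {x. z x \<in> B} 1) \<in> F" unfolding F_def using z(1) by force
  moreover have "bounded (closure (G {x. z x \<in> B} 1))"
  proof -
    have "G {x. z x \<in> B} 1 \<subseteq> convex hull (z ` {x. z x \<in> B})"
      unfolding G_def H_snd[symmetric] by blast
    moreover have "bounded (z ` {x. z x \<in> B})" by (rule bounded_subset[OF z(2)]) auto
    ultimately show ?thesis using bounded_convex_hull bounded_subset bounded_closure by metis
  qed
  ultimately have "\<Inter>F \<noteq> {}" by (rule nonsquare_convex_compact[OF ns])
  then obtain q where q: "\<And>S. S \<in> F \<Longrightarrow> q \<in> S" by blast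
  have "(p, q) \<in> closure (H A)" if "eventually (\<lambda>x. x \<in> A) W" for A
    unfolding closure_approachable
  proof (intro allI impI)
    fix e :: real assume "0 < e"
    then have "closure (G A (e / 2)) \<in> F" using that unfolding F_def by force
    then have "q \<in> closure (G A (e / 2))" by (rule q)
    then obtain b where "b \<in> G A (e / 2)" "dist q b < e / 2"
      using closure_approachableD \<open>0 < e\<close> half_gt_zero by blast
    then obtain a where a: "(a, b) \<in> H A" "dist p a \<le> e / 2" "dist q b < e / 2"
      unfolding G_def by auto
    have "dist (a, b) (p, q) \<le> dist a p + dist b q"
      unfolding dist_Pair_Pair by (rule sqrt_sum_squares_le_sum) simp_all
    with a show "\<exists>y\<in>H A. dist y (p, q) < e"
      by (intro bexI[of _ "(a, b)"]) (simp_all add: dist_commute)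
  qed
  then show thesis using that unfolding conv_cluster_def H_def by blast
qed

section \<open>Minimal invariant sets\<close>

lemma minimal_invariant_subset:
  fixes C :: "'a::banach set"
  assumes ns: "uniformly_nonsquare TYPE('a)"
    and C: "C \<noteq> {}" "closed C" "bounded C" "convex C" "T \<in> C \<rightarrow> C"
  obtains K where "K \<subseteq> C" "K \<noteq> {}" "closed K" "convex K" "T \<in> K \<rightarrow> K"
    "\<And>L. L \<subseteq> K \<Longrightarrow> L \<noteq> {} \<Longrightarrow> closed L \<Longrightarrow> convex L \<Longrightarrow> T \<in> L \<rightarrow> L \<Longrightarrow> L = K"
proof -
  let ?P = "\<lambda>S. closed S \<and> convex S \<and> T \<in> S \<rightarrow> S"
  have "fip {C}" using C(1) by (auto simp: fip_def subset_singleton_iff)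
  then obtain M where M: "{C} \<subseteq> M" "fip M" "\<And>S. S \<in> M \<Longrightarrow> ?P S"
    and max: "\<And>S. ?P S \<Longrightarrow> fip (insert S M) \<Longrightarrow> S \<in> M"
    using maximal_fip_extension[of "{C}" ?P] C by (metis singletonD)
  show thesis
  proof (rule that[of "\<Inter>M"])
    show "\<Inter>M \<subseteq> C" using M(1) by blast
    show "\<Inter>M \<noteq> {}"
      by (rule nonsquare_convex_compact[OF ns M(2) _ _ C(3)]) (use M in auto)
    show "closed (\<Inter>M)" "convex (\<Inter>M)" using M(3) by (auto intro!: closed_Inter convex_Inter)
    show "T \<in> \<Inter>M \<rightarrow> \<Inter>M" using M(3) by blast
    fix L assume L: "L \<subseteq> \<Inter>M" "L \<noteq> {}" "closed L" "convex L" "T \<in> L \<rightarrow> L"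
    \<comment> \<open>\<open>L\<close> lies in every member of \<open>M\<close>; maximality then
      makes \<open>L\<close> itself a member, so it contains the intersection.\<close>
    have "fip (insert L M)" by (rule fip_insert) (use L(1,2) in blast)
    then have "L \<in> M" using max L by blast
    with L(1) show "L = \<Inter>M" by blast
  qed
qed

text \<open>
  Goebel--Karlovitz lemma, in a form without sequences.
\<close>

lemma minimal_invariant_norm_ge:
  fixes K :: "'a::banach set"
  assumes ns: "uniformly_nonsquare TYPE('a)"
    and K: "closed K" "convex K" "bounded K" "T \<in> K \<rightarrow> K" "nonexpansive_on K T"
    and min: "\<And>L. L \<subseteq> K \<Longrightarrow> L \<noteq> {} \<Longrightarrow> closed L \<Longrightarrow> convex L \<Longrightarrow> T \<in> L \<rightarrow> L \<Longrightarrow> L = K"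
    and "p \<in> K" "0 < \<eta>"
  shows "\<exists>s>0. \<forall>z\<in>K. norm (T z - z) \<le> s \<longrightarrow> diameter K - \<eta> \<le> norm (z - p)"
proof (rule ccontr)
  assume "\<not> ?thesis"
  then have neg: "\<exists>z\<in>K. norm (T z - z) \<le> s \<and> norm (z - p) < diameter K - \<eta>" if "0 < s" for s
    using that by (meson not_le)
  define \<rho> where "\<rho> = diameter K - \<eta>"
  define B where "B s = {z\<in>K. norm (T z - z) \<le> s \<and> norm (z - p) \<le> \<rho>}" for s
  have B_ne: "B s \<noteq> {}" if "0 < s" for s
    using neg[OF that] unfolding B_def \<rho>_def by force
  have B_mono: "B s \<subseteq> B s'" if "s \<le> s'" for s s' using that unfolding B_def by auto
  \<comment> \<open>\<open>A\<close> is a sublevel set of an asymptotic radius: the upper limit of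
    \<open>norm (x - z)\<close> over ever better approximate fixed points \<open>z\<close> within
    \<open>\<rho>\<close> of \<open>p\<close> is at most \<open>\<rho>\<close>.\<close>
  define A where "A = {x\<in>K. \<forall>e>0. \<exists>s>0. \<forall>z\<in>B s. norm (x - z) \<le> \<rho> + e}"
  have nonexp: "norm (T x - T y) \<le> norm (x - y)" if "x \<in> K" "y \<in> K" for x y
    using K(5) that by (simp add: nonexpansive_on_def)
  have "A = K"
  proof (rule min)
    show "A \<subseteq> K" unfolding A_def by blast
    have "norm (p - z) \<le> \<rho> + e" if "z \<in> B 1" "0 < e" for z and e :: real
      using that by (simp add: B_def norm_minus_commute)
    then have "p \<in> A"
      unfolding A_def using \<open>p \<in> K\<close> zero_less_one by blast
    then show "A \<noteq> {}" by blast
    show "closed A"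
      unfolding closed_sequential_limits
    proof (intro allI impI)
      fix f l assume "(\<forall>n. f n \<in> A) \<and> f \<longlonglongrightarrow> l"
      then have f: "f n \<in> A" "f \<longlonglongrightarrow> l" for n by simp_all
      have "l \<in> K"
        by (rule closed_sequentially[OF K(1) _ f(2)]) (use f(1) \<open>A \<subseteq> K\<close> in auto)
      moreover have "\<exists>s>0. \<forall>z\<in>B s. norm (l - z) \<le> \<rho> + e" if "0 < e" for e
      proof -
        obtain n where n: "norm (f n - l) < e / 2"
          using LIMSEQ_D[OF f(2), of "e / 2"] \<open>0 < e\<close> by auto
        obtain s where s: "0 < s" "\<And>z. z \<in> B s \<Longrightarrow> norm (f n - z) \<le> \<rho> + e / 2"
          using f(1)[of n] half_gt_zero[OF \<open>0 < e\<close>] unfolding A_def by blast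
        have "norm (l - z) \<le> \<rho> + e" if "z \<in> B s" for z
          using norm_triangle_ineq4[of "f n - z" "f n - l"] s(2)[OF that] n by simp
        with s(1) show ?thesis by blast
      qed
      ultimately show "l \<in> A" unfolding A_def by blast
    qed
    show "convex A"
    proof (rule convexI)
      fix x y and u v :: real assume xy: "x \<in> A" "y \<in> A" and uv: "0 \<le> u" "0 \<le> v" "u + v = 1"
      have "\<exists>s>0. \<forall>z\<in>B s. norm (u *\<^sub>R x + v *\<^sub>R y - z) \<le> \<rho> + e" if "0 < e" for e
      proof -
        obtain s where s: "0 < s" "\<And>z. z \<in> B s \<Longrightarrow> norm (x - z) \<le> \<rho> + e"
          using xy(1) \<open>0 < e\<close> unfolding A_def by blast
        obtain t where t: "0 < t" "\<And>z. z \<in> B t \<Longrightarrow> norm (y - z) \<le> \<rho> + e"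
          using xy(2) \<open>0 < e\<close> unfolding A_def by blast
        have "norm (u *\<^sub>R x + v *\<^sub>R y - z) \<le> \<rho> + e" if "z \<in> B (min s t)" for z
        proof -
          have "z \<in> B s" "z \<in> B t" using that B_mono[of "min s t" s] B_mono[of "min s t" t] by auto
          then have "x \<in> cball z (\<rho> + e)" "y \<in> cball z (\<rho> + e)"
            using s(2)[of z] t(2)[of z] by (simp_all add: dist_norm norm_minus_commute)
          from convexD[OF convex_cball this uv] show ?thesis
            by (simp add: dist_norm norm_minus_commute)
        qed
        then show ?thesis using s(1) t(1) by (intro exI[of _ "min s t"]) simp
      qed
      moreover have "u *\<^sub>R x + v *\<^sub>R y \<in> K" using convexD[OF K(2)] xy uv unfolding A_def by blast
      ultimately show "u *\<^sub>R x + v *\<^sub>R y \<in> A" unfolding A_def by blast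
    qed
    show "T \<in> A \<rightarrow> A"
    proof
      fix x assume x: "x \<in> A"
      then have xK: "x \<in> K" unfolding A_def by blast
      have "\<exists>s>0. \<forall>z\<in>B s. norm (T x - z) \<le> \<rho> + e" if "0 < e" for e
      proof -
        have "0 < e / 2" using \<open>0 < e\<close> by simp
        then obtain s where s: "0 < s" "\<And>z. z \<in> B s \<Longrightarrow> norm (x - z) \<le> \<rho> + e / 2"
          using x unfolding A_def by blast
        have "norm (T x - z) \<le> \<rho> + e" if z: "z \<in> B (min s (e / 2))" for z
        proof -
          have "norm (x - z) \<le> \<rho> + e / 2" using s(2) z B_mono[of "min s (e / 2)" s] by auto
          moreover have "norm (T z - z) \<le> e / 2" "z \<in> K" using z unfolding B_def by auto
          ultimately show ?thesis
            using nonexp[OF xK \<open>z \<in> K\<close>] norm_triangle_ineq[of "T x - T z" "T z - z"] by simp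
        qed
        then show ?thesis using s(1) \<open>0 < e / 2\<close> by (intro exI[of _ "min s (e / 2)"]) simp
      qed
      moreover have "T x \<in> K" using K(4) xK by blast
      ultimately show "T x \<in> A" unfolding A_def by blast
    qed
  qed
  \<comment> \<open>The slack \<open>\<eta> / 2\<close> turns the asymptotic bounds into actual ones
    for finitely many points at once, while \<open>\<rho>'\<close> stays below the diameter.
    Compactness then gives a point of \<open>K\<close> within \<open>\<rho>'\<close> of all of
    \<open>K\<close>.\<close>
  define \<rho>' where "\<rho>' = \<rho> + \<eta> / 2"
  define F where "F = insert K ((\<lambda>y. cball y \<rho>') ` K)"
  have "fip F"
    unfolding F_def
  proof (rule fip_insert)
    fix D assume D: "D \<subseteq> (\<lambda>y. cball y \<rho>') ` K" "finite D"
    then obtain Y where Y: "Y \<subseteq> K" "finite Y" "D = (\<lambda>y. cball y \<rho>') ` Y"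
      using finite_subset_image by metis
    have "\<exists>s>0. \<forall>y\<in>Y. \<forall>z\<in>B s. norm (y - z) \<le> \<rho>'"
      using Y(2,1)
    proof (induction Y rule: finite_induct)
      case empty
      show ?case by (intro exI[of _ 1]) simp
    next
      case (insert y Y)
      then obtain s where s: "0 < s" "\<And>y z. y \<in> Y \<Longrightarrow> z \<in> B s \<Longrightarrow> norm (y - z) \<le> \<rho>'" by auto
      have "0 < \<eta> / 2" "y \<in> A" using \<open>0 < \<eta>\<close> insert.prems \<open>A = K\<close> by auto
      then obtain t where t: "0 < t" "\<And>z. z \<in> B t \<Longrightarrow> norm (y - z) \<le> \<rho>'"
        unfolding A_def \<rho>'_def by blast
      show ?case
        using s t B_mono[of "min s t" s] B_mono[of "min s t" t] by (intro exI[of _ "min s t"]) auto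
    qed
    then obtain s where s: "0 < s" "\<And>y z. y \<in> Y \<Longrightarrow> z \<in> B s \<Longrightarrow> norm (y - z) \<le> \<rho>'" by blast
    obtain z where z: "z \<in> B s" using B_ne[OF s(1)] by blast
    then have "z \<in> K \<inter> \<Inter>D" using s(2)[OF _ z] unfolding Y(3) by (simp add: dist_norm B_def)
    then show "K \<inter> \<Inter>D \<noteq> {}" by blast
  qed
  then have "\<Inter>F \<noteq> {}"
    by (rule nonsquare_convex_compact[OF ns _ _ _ K(3)]) (use K in \<open>auto simp: F_def\<close>)
  then obtain x0 where "x0 \<in> \<Inter>F" by blast
  then have x0: "x0 \<in> K" "norm (y - x0) \<le> \<rho>'" if "y \<in> K" for y
    using that by (auto simp: F_def dist_norm)
  define D where "D = K \<inter> (\<Inter>y\<in>K. cball y \<rho>')"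
  have "D = K"
  proof (rule min)
    show "D \<subseteq> K" unfolding D_def by blast
    have "x0 \<in> D" using x0 \<open>p \<in> K\<close> by (simp add: D_def dist_norm)
    then show "D \<noteq> {}" by blast
    show "closed D" unfolding D_def using K(1) by (intro closed_Int closed_INT) auto
    show "convex D" unfolding D_def using K(2) by (intro convex_Int convex_INT) auto
    show "T \<in> D \<rightarrow> D"
    proof
      fix x assume x: "x \<in> D"
      then have xK: "x \<in> K" unfolding D_def by blast
      then have TxK: "T x \<in> K" using K(4) by blast
      \<comment> \<open>\<open>T\<close> maps \<open>K\<close> into the ball around
        \<open>T x\<close>, so the part of \<open>K\<close> in this ball is invariant and equals
        \<open>K\<close> by minimality. Thus \<open>T x\<close> is again a centre.\<close>
      have image: "T y \<in> K \<inter> cball (T x) \<rho>'" if "y \<in> K" for y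
      proof -
        have "norm (y - x) \<le> \<rho>'" using x that by (simp add: D_def dist_norm)
        then show ?thesis
          using nonexp[OF xK that] K(4) that by (auto simp: dist_norm norm_minus_commute)
      qed
      have "K \<inter> cball (T x) \<rho>' = K"
      proof (rule min)
        show "K \<inter> cball (T x) \<rho>' \<noteq> {}" using image[OF xK] by blast
        show "closed (K \<inter> cball (T x) \<rho>')" using K(1) by (intro closed_Int) auto
        show "convex (K \<inter> cball (T x) \<rho>')" using K(2) by (intro convex_Int) auto
        show "T \<in> K \<inter> cball (T x) \<rho>' \<rightarrow> K \<inter> cball (T x) \<rho>'" using image by blast
      qed simp
      then have "y \<in> cball (T x) \<rho>'" if "y \<in> K" for y using that by blast
      then show "T x \<in> D" using TxK unfolding D_def by (simp add: dist_commute)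
    qed
  qed
  have "diameter K \<le> \<rho>'"
  proof (rule diameter_le)
    show "K \<noteq> {} \<or> 0 \<le> \<rho>'" using \<open>p \<in> K\<close> by blast
    fix x y assume "x \<in> K" "y \<in> K"
    then have "x \<in> cball y \<rho>'" using \<open>D = K\<close> unfolding D_def by blast
    then show "norm (x - y) \<le> \<rho>'" by (simp add: dist_norm norm_minus_commute)
  qed
  then show False using \<open>0 < \<eta>\<close> unfolding \<rho>'_def \<rho>_def by simp
qed

section \<open>Perturbed fixed points and the final contradiction\<close>

lemma nonexpansive_perturbed_fixed_point:
  fixes K :: "'a::banach set"
  assumes K: "closed K" "convex K" "T \<in> K \<rightarrow> K" "nonexpansive_on K T"
    and "y \<in> K" "0 < s" "s < 1"
  obtains z where "z \<in> K" "z = (1 - s) *\<^sub>R T z + s *\<^sub>R y"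
proof -
  let ?f = "\<lambda>z. (1 - s) *\<^sub>R T z + s *\<^sub>R y"
  have "\<exists>!z\<in>K. ?f z = z"
  proof (rule Banach_fix)
    show "complete K" using K(1) by (simp add: complete_eq_closed)
    show "?f ` K \<subseteq> K"
      using K(3) \<open>y \<in> K\<close> \<open>0 < s\<close> \<open>s < 1\<close> by (auto intro!: convexD[OF K(2)])
    fix u v assume "u \<in> K" "v \<in> K"
    then have "norm (T u - T v) \<le> norm (u - v)" using K(4) by (simp add: nonexpansive_on_def)
    moreover have "?f u - ?f v = (1 - s) *\<^sub>R (T u - T v)" by (simp add: algebra_simps)
    then have "norm (?f u - ?f v) = (1 - s) * norm (T u - T v)" using \<open>s < 1\<close> by simp
    ultimately show "dist (?f u) (?f v) \<le> (1 - s) * dist u v"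
      using \<open>s < 1\<close> by (simp add: dist_norm mult_left_mono)
  qed (use assms in auto)
  then show thesis using that by metis
qed

theorem corollary3p2:
  assumes "uniformly_nonsquare TYPE('a::banach)"
  shows "fixed_point_property TYPE('a)"
  unfolding fixed_point_property_def
proof (intro allI impI, elim conjE, rule ccontr)
  fix C :: "'a set" and T
  assume C: "C \<noteq> {}" "closed C" "bounded C" "convex C" "T \<in> C \<rightarrow> C" "nonexpansive_on C T"
    and no_fp: "\<not> (\<exists>x\<in>C. T x = x)"
  obtain K where K: "K \<subseteq> C" "K \<noteq> {}" "closed K" "convex K" "T \<in> K \<rightarrow> K"
    and min: "\<And>L. L \<subseteq> K \<Longrightarrow> L \<noteq> {} \<Longrightarrow> closed L \<Longrightarrow> convex L \<Longrightarrow> T \<in> L \<rightarrow> L \<Longrightarrow> L = K"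
    using minimal_invariant_subset[OF assms C(1-5)] by metis
  have bK: "bounded K" using C(3) K(1) bounded_subset by blast
  have neK: "nonexpansive_on K T" using C(6) K(1) unfolding nonexpansive_on_def by blast
  then have nonexp: "norm (T x - T y) \<le> norm (x - y)" if "x \<in> K" "y \<in> K" for x y
    using that by (simp add: nonexpansive_on_def)
  have TK: "T x \<in> K" if "x \<in> K" for x using K(5) that by blast
  define d where "d = diameter K"
  have diam: "norm (x - y) \<le> d" if "x \<in> K" "y \<in> K" for x y
    using diameter_bounded_bound[OF bK that] by (simp add: d_def dist_norm)
  have "0 < d"
  proof -
    obtain x where "x \<in> K" using K(2) by blast
    moreover have "T x \<noteq> x" using no_fp K(1) \<open>x \<in> K\<close> by blast
    ultimately show ?thesis using diam[OF TK, of x x] by (smt (verit) right_minus_eq zero_less_norm_iff)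
  qed
  obtain \<delta> where \<delta>: "0 < \<delta>" "\<delta> < 1"
    and ns: "\<And>x y :: 'a. min (norm ((x + y) /\<^sub>R 2)) (norm ((x - y) /\<^sub>R 2)) \<le> (1 - \<delta>) * max (norm x) (norm y)"
    using uniformly_nonsquareE[OF assms] by blast
  have perturbed: "\<exists>z\<in>K. z = (1 - s) *\<^sub>R T z + s *\<^sub>R y" if "y \<in> K" "0 < s" "s < 1" for y s
    using nonexpansive_perturbed_fixed_point[OF K(3-5) neK that] by blast
  have residual: "norm (T z - z) \<le> s * d"
    if "z \<in> K" "y \<in> K" "0 < s" "z = (1 - s) *\<^sub>R T z + s *\<^sub>R y" for z y s
  proof -
    have "T z - ((1 - s) *\<^sub>R T z + s *\<^sub>R y) = s *\<^sub>R (T z - y)" by (simp add: algebra_simps)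
    then have "T z - z = s *\<^sub>R (T z - y)" using that(4) by simp
    then have "norm (T z - z) = s * norm (T z - y)" using \<open>0 < s\<close> by simp
    then show ?thesis using diam[OF TK[OF that(1)] that(2)] \<open>0 < s\<close> by simp
  qed
  define E where "E s = {z\<in>K. norm (T z - z) \<le> s}" for s
  have E_ne: "E s \<noteq> {}" if "0 < s" for s
  proof -
    obtain y where "y \<in> K" using K(2) by blast
    \<comment> \<open>The bound \<open>1 / 2\<close> keeps the perturbed map a contraction with
      \<open>t < 1\<close>; \<open>s / d\<close> makes the residual at most
      \<open>s\<close>.\<close>
    define t where "t = min (1 / 2) (s / d)"
    have t: "0 < t" "t < 1" "t * d \<le> s"
      using \<open>0 < s\<close> \<open>0 < d\<close> by (auto simp: t_def min_def field_simps)
    from perturbed[OF \<open>y \<in> K\<close> t(1,2)] obtain z where z: "z \<in> K" "z = (1 - t) *\<^sub>R T z + t *\<^sub>R y" by blast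
    then have "z \<in> E s" using residual[OF z(1) \<open>y \<in> K\<close> t(1) z(2)] t(3) unfolding E_def by simp
    then show ?thesis by blast
  qed
  have "fip (E ` {0<..})"
    unfolding fip_def
  proof (intro allI impI)
    fix D assume D: "D \<subseteq> E ` {0<..}" "finite D"
    then obtain Y where Y: "Y \<subseteq> {0<..}" "finite Y" "D = E ` Y"
      using finite_subset_image by metis
    \<comment> \<open>Inserting 1 covers the case of empty \<open>Y\<close>.\<close>
    define s where "s = Min (insert 1 Y)"
    have "0 < s" "\<And>y. y \<in> Y \<Longrightarrow> s \<le> y"
      using Y(1,2) by (auto simp: s_def)
    then have "E s \<subseteq> \<Inter>D" unfolding Y(3) E_def by fastforce
    with E_ne[OF \<open>0 < s\<close>] show "\<Inter>D \<noteq> {}" by blast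
  qed
  then obtain W where W1: "ultra W" and W2: "\<And>S. S \<in> E ` {0<..} \<Longrightarrow> eventually (\<lambda>x. x \<in> S) W"
    using ultrafilter_of_fip[of "E ` {0<..}"] by blast
  have W2: "eventually (\<lambda>x. x \<in> E s) W" if "0 < s" for s
    using W2[of "E s"] that by simp
  have W_ne: "W \<noteq> bot" using W1 by (simp add: ultra_def)
  have W_K: "eventually (\<lambda>x. x \<in> K) W"
    using W2[of 1] by (rule eventually_mono) (simp_all add: E_def)
  \<comment> \<open>A constant first component lets the joint lemma produce a weak limit
    \<open>p\<close> of the points \<open>x\<close> alone.\<close>
  have "conv_cluster W (\<lambda>_. 0 :: real) 0"
    unfolding conv_cluster_def
  proof (intro allI impI)
    fix A assume "eventually (\<lambda>x. x \<in> A) W"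
    then obtain x where "x \<in> A" using eventually_happens'[OF W_ne] by blast
    then have "(0 :: real) \<in> (\<lambda>_. 0) ` A" by blast
    then show "(0 :: real) \<in> closure (convex hull ((\<lambda>_. 0) ` A))"
      by (rule closure_convex_hull_inc)
  qed
  from conv_cluster_joint[OF assms this W_K bK]
  obtain p where p0: "conv_cluster W (\<lambda>x. (0 :: real, x)) (0, p)" .
  have p: "conv_cluster W (\<lambda>x. x) p"
    unfolding conv_cluster_def
  proof (intro allI impI)
    fix A assume A: "eventually (\<lambda>x. x \<in> A) W"
    have "(0 :: real, p) \<in> UNIV \<times> closure (convex hull A)"
    proof (rule conv_cluster_mem[OF p0])
      show "eventually (\<lambda>x. (0 :: real, x) \<in> UNIV \<times> closure (convex hull A)) W"
        using A by (rule eventually_mono) (simp add: closure_convex_hull_inc)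
    qed (simp_all add: closed_Times convex_Times)
    then show "p \<in> closure (convex hull ((\<lambda>x. x) ` A))" by simp
  qed
  have "p \<in> K" by (rule conv_cluster_mem[OF p W_K K(3,4)])
  \<comment> \<open>The contradiction at the end requires
    \<open>2 * \<eta> < \<delta> * d\<close>.\<close>
  define \<eta> where "\<eta> = \<delta> * d / 5"
  have "0 < \<eta>" using \<delta> \<open>0 < d\<close> by (simp add: \<eta>_def)
  have "\<exists>s>0. \<forall>z\<in>K. norm (T z - z) \<le> s \<longrightarrow> d - \<eta> \<le> norm (z - p)"
    unfolding d_def
    by (rule minimal_invariant_norm_ge[OF assms K(3,4) bK K(5) neK min \<open>p \<in> K\<close> \<open>0 < \<eta>\<close>])
  then obtain s0 where s0: "0 < s0"
    "\<And>z. z \<in> K \<Longrightarrow> norm (T z - z) \<le> s0 \<Longrightarrow> d - \<eta> \<le> norm (z - p)"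
    by blast
  define s where "s = min (1 / 2) (s0 / d)"
  have s: "0 < s" "s < 1" "s * d \<le> s0"
    using \<open>0 < s0\<close> \<open>0 < d\<close> by (auto simp: s_def min_def field_simps)
  define y where "y x = (1 / 2) *\<^sub>R p + (1 / 2) *\<^sub>R x" for x
  have yK: "y x \<in> K" if "x \<in> K" for x
    unfolding y_def using that \<open>p \<in> K\<close> by (intro convexD[OF K(4)]) simp_all
  have "\<forall>x\<in>K. \<exists>z\<in>K. z = (1 - s) *\<^sub>R T z + s *\<^sub>R y x" using perturbed[OF yK s(1,2)] by blast
  then obtain z where z: "\<And>x. x \<in> K \<Longrightarrow> z x \<in> K"
    "\<And>x. x \<in> K \<Longrightarrow> z x = (1 - s) *\<^sub>R T (z x) + s *\<^sub>R y x"
    by metis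
  have far: "d - \<eta> \<le> norm (z x - p)" if "x \<in> K" for x
    using s0(2)[OF z(1)[OF that]] residual[OF z(1)[OF that] yK[OF that] s(1) z(2)[OF that]] s(3) by linarith
  \<comment> \<open>In the difference of the two equations \<open>p\<close> cancels. Moving the
    nonexpansive term to the left leaves \<open>s\<close> times the distance, bounded by
    \<open>s * d / 2\<close>.\<close>
  have close: "norm (z x - z x') \<le> d / 2" if "x \<in> K" "x' \<in> K" for x x'
  proof -
    have "z x - z x' = (1 - s) *\<^sub>R (T (z x) - T (z x')) + (s / 2) *\<^sub>R (x - x')"
      by (subst z(2)[OF that(1)], subst z(2)[OF that(2)]) (simp add: y_def algebra_simps)
    then have "norm (z x - z x') \<le> (1 - s) * norm (T (z x) - T (z x')) + (s / 2) * norm (x - x')"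
      using norm_triangle_ineq[of "(1 - s) *\<^sub>R (T (z x) - T (z x'))" "(s / 2) *\<^sub>R (x - x')"] s by simp
    also have "\<dots> \<le> (1 - s) * norm (z x - z x') + (s / 2) * d"
      using nonexp[OF z(1)[OF that(1)] z(1)[OF that(2)]] diam[OF that] s
      by (intro add_mono mult_left_mono) simp_all
    finally have "s * norm (z x - z x') \<le> s * (d / 2)" by (simp add: algebra_simps)
    then show ?thesis using s(1) by simp
  qed
  \<comment> \<open>The final division by \<open>s\<close> explains the tolerance
    \<open>s * e\<close>.\<close>
  have near: "norm (z x - x) \<le> d / 2 + e" if "x \<in> E (s * e)" for x e
  proof -
    have x: "x \<in> K" "norm (T x - x) \<le> s * e" using that by (simp_all add: E_def)
    have "z x - x = (1 - s) *\<^sub>R (T (z x) - x) + (s / 2) *\<^sub>R (p - x)"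
      by (subst z(2)[OF x(1)]) (simp add: y_def algebra_simps flip: scaleR_add_left)
    then have "norm (z x - x) \<le> (1 - s) * norm (T (z x) - x) + (s / 2) * norm (p - x)"
      using norm_triangle_ineq[of "(1 - s) *\<^sub>R (T (z x) - x)" "(s / 2) *\<^sub>R (p - x)"] s by simp
    also have "\<dots> \<le> (1 - s) * (norm (z x - x) + s * e) + (s / 2) * d"
    proof (intro add_mono mult_left_mono)
      show "norm (T (z x) - x) \<le> norm (z x - x) + s * e"
        using norm_triangle_ineq[of "T (z x) - T x" "T x - x"] nonexp[OF z(1)[OF x(1)] x(1)] x(2) by simp
    qed (use s diam[OF \<open>p \<in> K\<close> x(1)] in simp_all)
    finally have "s * norm (z x - x) \<le> (1 - s) * (s * e) + s * (d / 2)" by (simp add: algebra_simps)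
    also have "(1 - s) * (s * e) \<le> s * e"
      using order_trans[OF norm_ge_zero x(2)] s by (simp add: mult_left_le_one_le)
    finally have "s * norm (z x - x) \<le> s * (d / 2 + e)" by (simp add: algebra_simps)
    then show ?thesis using s(1) by simp
  qed
  have W_z: "eventually (\<lambda>x. z x \<in> K) W" using W_K by (rule eventually_mono) (rule z(1))
  obtain q where q: "conv_cluster W (\<lambda>x. (x, z x)) (p, q)"
    using conv_cluster_joint[OF assms p W_z bK] .
  \<comment> \<open>The pairs \<open>(x, z x)\<close> eventually lie in a closed convex set
    determined by \<open>near\<close>, so \<open>(p, q)\<close> does too.\<close>
  have "norm (q - p) \<le> d / 2"
  proof (rule field_le_epsilon)
    fix e :: real assume "0 < e"
    let ?S = "(\<lambda>w. snd w - fst w) -` cball 0 (d / 2 + e) :: ('a \<times> 'a) set"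
    have "(p, q) \<in> ?S"
    proof (rule conv_cluster_mem[OF q])
      show "eventually (\<lambda>x. (x, z x) \<in> ?S) W"
        by (rule eventually_mono[OF W2[of "s * e"]]) (use s(1) \<open>0 < e\<close> in \<open>auto dest: near\<close>)
      show "closed ?S" by (intro closed_vimage continuous_intros) simp
      show "convex ?S"
        by (intro convex_linear_vimage convex_cball linear_compose_sub linear_fst linear_snd)
    qed
    then show "norm (q - p) \<le> d / 2 + e" by simp
  qed
  \<comment> \<open>Otherwise \<open>z x'\<close> would eventually lie in a ball around
    \<open>q - p + z x\<close>, hence so would \<open>q\<close>, putting \<open>z x\<close> too
    close to \<open>p\<close>.\<close>
  have q_ev: "eventually (\<lambda>x'. d - 2 * \<eta> \<le> norm (q - p + z x - z x')) W" if "x \<in> K" for x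
  proof (rule ccontr)
    assume "\<not> ?thesis"
    then have "eventually (\<lambda>x'. \<not> d - 2 * \<eta> \<le> norm (q - p + z x - z x')) W"
      using W1 unfolding ultra_def by blast
    then have "eventually (\<lambda>x'. (x', z x') \<in> UNIV \<times> cball (q - p + z x) (d - 2 * \<eta>)) W"
      by (rule eventually_mono) (simp add: dist_norm)
    from conv_cluster_mem[OF q this]
    have "q \<in> cball (q - p + z x) (d - 2 * \<eta>)" by (simp add: closed_Times convex_Times)
    then show False using far[OF that] \<open>0 < \<eta>\<close> by (simp add: dist_norm algebra_simps)
  qed
  \<comment> \<open>Approximating \<open>q\<close> from finitely many \<open>z x\<close> allows one
    \<open>x'\<close> to satisfy \<open>q_ev\<close> for all \<open>x\<close> in \<open>I\<close>
    simultaneously.\<close>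
  obtain I b where I: "finite I" "I \<subseteq> K" "b \<in> convex hull (z ` I)" "norm (b - q) < \<eta>"
  proof -
    have "(p, q) \<in> UNIV \<times> closure (convex hull (z ` K))"
    proof (rule conv_cluster_mem[OF q])
      show "eventually (\<lambda>x. (x, z x) \<in> UNIV \<times> closure (convex hull (z ` K))) W"
        using W_K by (rule eventually_mono) (simp add: closure_convex_hull_inc)
    qed (simp_all add: closed_Times convex_Times)
    then obtain b where b: "b \<in> convex hull (z ` K)" "dist q b < \<eta>"
      using closure_approachableD \<open>0 < \<eta>\<close> by blast
    then obtain S where S: "finite S" "S \<subseteq> z ` K" "b \<in> convex hull S"
      unfolding convex_hull_explicit by blast
    then obtain I where "I \<subseteq> K" "finite I" "S = z ` I" using finite_subset_image by metis
    then show thesis using that[of I b] S b by (simp add: dist_norm norm_minus_commute)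
  qed
  have "eventually (\<lambda>x'. x' \<in> K \<and> (\<forall>x\<in>I. d - 2 * \<eta> \<le> norm (q - p + z x - z x'))) W"
    by (intro eventually_conj W_K eventually_ball_finite I(1)) (use I(2) q_ev in blast)
  then obtain x' where x': "x' \<in> K" "\<And>x. x \<in> I \<Longrightarrow> d - 2 * \<eta> \<le> norm (q - p + z x - z x')"
    using eventually_happens'[OF W_ne] by blast
  \<comment> \<open>Otherwise the ball contains all \<open>z x\<close> with \<open>x\<close> in
    \<open>I\<close>, hence \<open>b\<close>, and as \<open>b\<close> is close to \<open>q\<close>,
    \<open>z x'\<close> would be too close to \<open>p\<close>.\<close>
  have "\<exists>x\<in>I. d - 2 * \<eta> \<le> norm (q - p + z x' - z x)"
  proof (rule ccontr)
    assume "\<not> ?thesis"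
    then have "z ` I \<subseteq> ball (q - p + z x') (d - 2 * \<eta>)" by (auto simp: dist_norm not_le)
    then have "convex hull (z ` I) \<subseteq> ball (q - p + z x') (d - 2 * \<eta>)" by (intro hull_minimal) simp_all
    with I(3) have "norm (q - p + z x' - b) < d - 2 * \<eta>" by (auto simp: dist_norm)
    moreover have "norm (z x' - p) \<le> norm (q - p + z x' - b) + norm (b - q)"
      using norm_triangle_ineq[of "q - p + z x' - b" "b - q"] by simp
    ultimately show False using far[OF x'(1)] I(4) by linarith
  qed
  then obtain x where x: "x \<in> I" "d - 2 * \<eta> \<le> norm (q - p + z x' - z x)" by blast
  \<comment> \<open>Two vectors of norm at most \<open>d / 2\<close> whose sum and difference both
    have norm at least \<open>d - 2 * \<eta>\<close>: an almost perfect square.\<close>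
  have "max (norm (q - p)) (norm (z x - z x')) \<le> d / 2"
    using \<open>norm (q - p) \<le> d / 2\<close> close[OF subsetD[OF I(2) x(1)] x'(1)] by (rule max.boundedI)
  then have "(1 - \<delta>) * max (norm (q - p)) (norm (z x - z x')) \<le> (1 - \<delta>) * (d / 2)"
    using \<delta>(2) by (intro mult_left_mono) simp_all
  with ns[of "q - p" "z x - z x'"]
  have "min (norm ((q - p + (z x - z x')) /\<^sub>R 2)) (norm ((q - p - (z x - z x')) /\<^sub>R 2)) \<le> (1 - \<delta>) * (d / 2)"
    by (rule order_trans)
  moreover have "q - p + (z x - z x') = q - p + z x - z x'" "q - p - (z x - z x') = q - p + z x' - z x"
    by simp_all
  ultimately have "min (norm (q - p + z x - z x')) (norm (q - p + z x' - z x)) \<le> (1 - \<delta>) * d"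
    by (simp only: norm_scaleR) (simp add: min_le_iff_disj field_simps)
  then have "d - 2 * \<eta> \<le> (1 - \<delta>) * d" using x(2) x'(2)[OF x(1)] by linarith
  moreover have "0 < \<delta> * d" using \<delta>(1) \<open>0 < d\<close> by simp
  ultimately show False by (simp add: \<eta>_def algebra_simps)
qed

end
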